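(* Let $d\ge 1$, $r\ge 1$ and $n_1,\ldots,n_d\ge 3$ be integers, and let $\emptyset\neq\mathcal{A}\subseteq\mathbb{Z}_2^{d+r}\setminus\{\mathbf{0}\}$. Suppose that the first $d$ coordinates of each element of $\mathcal{A}$ are equal to $0$, and write $\mathbf{c}(\mathcal{A})=(0,\ldots,0,c_{d+1},\ldots,c_{d+r})$. Let $H_{\mathcal{A}}(t)$ be the transition matrix of $G=\mathrm{NEPS}(K_{n_1},\ldots,K_{n_d},r\odot K_2;\mathcal{A})$. (a) If $\mathbf{c}(\mathcal{A})\neq\mathbf{0}$, then $G$ admits perfect state transfer from vertex $\mathbf{u}$ to vertex $\mathbf{u}+\mathbf{c}(\mathcal{A})$ at time $\frac{\pi}{2}$, for every vertex $\mathbf{u}$, and $$H_{\mathcal{A}}\left(\tfrac{\pi}{2}\right)=(-\mathrm{i})^{|\mathcal{A}|}I_{n_1\cdots n_d}\otimes\Big(\bigotimes_{j=d+1}^{d+r}(A_{K_2})^{c_j}\Big).$$ (b) If $\mathbf{c}(\mathcal{A})=\mathbf{0}$, then $G$ is periodic with period $\frac{\pi}{2}$, and $H_{\mathcal{A}}(\frac{\pi}{2})=(-\mathrm{i})^{|\mathcal{A}|}I_{2^rn_1\cdots n_d}$.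
   Context: For a graph $G$ with adjacency matrix $A_G$, its transition matrix is $H_{A_G}(t)=\exp(-\mathrm{i}tA_G)$, $t\in\mathbb{R}$. Perfect state transfer (PST) from $u$ to $v$ at time $\tau$ means $u\ne v$ and $|H_{A_G}(\tau)_{u,v}|=1$. $G$ is periodic with period $\tau$ if $|H_{A_G}(\tau)_{u,u}|=1$ for every vertex $u$. For graphs $G_1,\ldots,G_m$ and $\emptyset\ne\mathcal{B}\subseteq\mathbb{Z}_2^m\setminus\{\mathbf{0}\}$, $\mathrm{NEPS}(G_1,\ldots,G_m;\mathcal{B})$ is the graph with vertex set $V(G_1)\times\cdots\times V(G_m)$ in which $(u_1,\ldots,u_m)$ and $(v_1,\ldots,v_m)$ are adjacent iff there is $(a_1,\ldots,a_m)\in\mathcal{B}$ with $u_i=v_i$ whenever $a_i=0$ and $u_i\sim v_i$ in $G_i$ whenever $a_i=1$. $\mathrm{NEPS}(K_{n_1},\ldots,K_{n_d},r\odot K_2;\mathcal{A})$ is the NEPS of $K_{n_1},\ldots,K_{n_d}$ followed by $r$ copies of $K_2$. Vertices of $K_{n_i}$ are identified with $\mathbb{Z}_{n_i}$ and vertices of $K_2$ with $\mathbb{Z}_2$; for a vertex $\mathbf{u}$ and $\mathbf{a}\in\mathbb{Z}_2^{d+r}$, $\mathbf{u}+\mathbf{a}$ is coordinatewise addition, modulo $n_i$ in coordinate $i\le d$ and modulo $2$ in coordinates $d+1,\ldots,d+r$. For $\mathcal{A}\subseteq\mathbb{Z}_2^m$, $\mathbf{c}(\mathcal{A})=\sum_{\mathbf{a}\in\mathcal{A}}\mathbf{a}$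 computed in $\mathbb{Z}_2^m$. Matrices are indexed by vertex tuples in lexicographic order compatible with the Kronecker product, $A_{K_2}=\begin{pmatrix}0&1\\1&0\end{pmatrix}$, and $M^0=I$. *)

theory Defs
  imports
    "HOL-Analysis.Analysis"
    "HOL-Library.Z2"
    "HOL-Library.List_Lexorder"
    "Jordan_Normal_Form.Matrix"
    "Graph_Theory.Pair_Digraph"
begin

definition mat_exp :: "complex mat \<Rightarrow> complex mat" where
  "mat_exp M = mat (dim_row M) (dim_row M) (\<lambda>(i, j). \<Sum>k. (M ^\<^sub>m k) $$ (i, j) / fact k)"

lemma mat_exp_summable:
  fixes M :: "complex mat"
  assumes M: "M \<in> carrier_mat n n" and i: "i < n" and j: "j < n"
  shows "summable (\<lambda>k. (M ^\<^sub>m k) $$ (i, j) / fact k)"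
proof -
  define c where "c = (\<Sum>i<n. \<Sum>j<n. cmod (M $$ (i, j)))"
  have c: "cmod (M $$ (i, j)) \<le> c" if "i < n" "j < n" for i j
  proof -
    have "cmod (M $$ (i, j)) \<le> (\<Sum>j<n. cmod (M $$ (i, j)))"
      using that by (intro member_le_sum) auto
    also have "\<dots> \<le> c"
      unfolding c_def using that
      by (intro member_le_sum[where f = "\<lambda>i. \<Sum>j<n. cmod (M $$ (i, j))"]) (auto intro: sum_nonneg)
    finally show ?thesis .
  qed
  have bound: "cmod ((M ^\<^sub>m k) $$ (i, j)) \<le> (real n * c) ^ k" if "i < n" "j < n" for i j k
    using that
  proof (induction k arbitrary: i j)
    case 0
    then show ?case using M by auto
  next
    case (Suc k)
    have Mk: "M ^\<^sub>m k \<in> carrier_mat n n" using M by simp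
    have "(M ^\<^sub>m Suc k) $$ (i, j) = (\<Sum>l<n. (M ^\<^sub>m k) $$ (i, l) * M $$ (l, j))"
      using Suc.prems M Mk by (simp add: scalar_prod_def lessThan_atLeast0)
    also have "cmod \<dots> \<le> (\<Sum>l<n. (real n * c) ^ k * c)"
      by (rule sum_norm_le) (auto simp: norm_mult intro!: mult_mono Suc c Suc.prems
        intro: order_trans[OF norm_ge_zero c[OF Suc.prems]] order_trans[OF norm_ge_zero Suc.IH])
    also have "\<dots> = (real n * c) ^ Suc k" by simp
    finally show ?case .
  qed
  show ?thesis
  proof (rule summable_comparison_test')
    show "summable (\<lambda>k. (real n * c) ^ k / fact k)"
      using summable_exp[of "real n * c"] by (simp add: divide_inverse mult.commute)
    show "norm ((M ^\<^sub>m k) $$ (i, j) / fact k) \<le> (real n * c) ^ k / fact k" if "0 \<le> k" for k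
      using bound[OF i j, of k] by (simp add: norm_divide divide_right_mono)
  qed
qed

definition kron :: "complex mat \<Rightarrow> complex mat \<Rightarrow> complex mat" (infixr \<open>\<otimes>\<^sub>K\<close> 72) where
  "M \<otimes>\<^sub>K N = mat (dim_row M * dim_row N) (dim_col M * dim_col N)
     (\<lambda>(i, j). M $$ (i div dim_row N, j div dim_col N) * N $$ (i mod dim_row N, j mod dim_col N))"

definition kron_list :: "complex mat list \<Rightarrow> complex mat" where
  "kron_list Ms = foldr (\<otimes>\<^sub>K) Ms (1\<^sub>m 1)"

text \<open>
  Rows and columns are indexed by the vertices in increasing order. For vertices that are lists
  (tuples), the order is the lexicographic one.
\<close>

definition vertex_list :: "('v::linorder) pair_pre_digraph \<Rightarrow> 'v list" where
  "vertex_list G = sorted_list_of_set (pverts G)"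

definition vertex_index :: "('v::linorder) pair_pre_digraph \<Rightarrow> 'v \<Rightarrow> nat" where
  "vertex_index G u = (THE i. i < length (vertex_list G) \<and> vertex_list G ! i = u)"

lemma vertex_index:
  assumes "finite (pverts G)" "u \<in> pverts G"
  shows "vertex_index G u < card (pverts G)" "vertex_list G ! vertex_index G u = u"
proof -
  have "\<exists>!i. i < length (vertex_list G) \<and> vertex_list G ! i = u"
    using assms unfolding vertex_list_def by (intro distinct_Ex1) auto
  from theI'[OF this] show "vertex_index G u < card (pverts G)" "vertex_list G ! vertex_index G u = u"
    unfolding vertex_index_def by (auto simp: vertex_list_def)
qed

definition adj_mat :: "('v::linorder) pair_pre_digraph \<Rightarrow> complex mat" where
  "adj_mat G = mat (card (pverts G)) (card (pverts G))
     (\<lambda>(i, j). if (vertex_list G ! i, vertex_list G ! j) \<in> parcs G then 1 else 0)"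

definition transition_mat :: "('v::linorder) pair_pre_digraph \<Rightarrow> real \<Rightarrow> complex mat" where
  "transition_mat G t = mat_exp ((- \<i> * complex_of_real t) \<cdot>\<^sub>m adj_mat G)"

definition transition_entry :: "('v::linorder) pair_pre_digraph \<Rightarrow> real \<Rightarrow> 'v \<Rightarrow> 'v \<Rightarrow> complex" where
  "transition_entry G t u v = transition_mat G t $$ (vertex_index G u, vertex_index G v)"

definition perfect_state_transfer :: "('v::linorder) pair_pre_digraph \<Rightarrow> 'v \<Rightarrow> 'v \<Rightarrow> real \<Rightarrow> bool" where
  "perfect_state_transfer G u v \<tau> \<longleftrightarrow>
     u \<in> pverts G \<and> v \<in> pverts G \<and> u \<noteq> v \<and> cmod (transition_entry G \<tau> u v) = 1"

definition periodic_graph :: "('v::linorder) pair_pre_digraph \<Rightarrow> real \<Rightarrow> bool" where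
  "periodic_graph G \<tau> \<longleftrightarrow> (\<forall>u\<in>pverts G. cmod (transition_entry G \<tau> u u) = 1)"

definition complete_graph :: "nat \<Rightarrow> nat pair_pre_digraph" where
  "complete_graph n = \<lparr>pverts = {0..<n}, parcs = {(u, v). u < n \<and> v < n \<and> u \<noteq> v}\<rparr>"

lemma adj_mat_K2: "adj_mat (complete_graph 2) = mat_of_rows_list 2 [[0, 1], [1, 0]]"
proof -
  have "vertex_list (complete_graph 2) = [0, 1]"
    by (simp add: vertex_list_def complete_graph_def sorted_list_of_set_range upt_rec)
  then show ?thesis
    by (intro eq_matI)
      (auto simp: adj_mat_def complete_graph_def mat_of_rows_list_def numeral_2_eq_2 less_Suc_eq)
qed

text \<open>Elements of the vector space of dimension \<open>m\<close> over the two-element field \<^typ>\<open>bit\<close> are lists of length \<open>m\<close>.\<close>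

definition Z2_space :: "nat \<Rightarrow> bit list set" where
  "Z2_space m = {a. length a = m}"

definition Z2_zero :: "nat \<Rightarrow> bit list" where
  "Z2_zero m = replicate m 0"

definition Z2_sum :: "nat \<Rightarrow> bit list set \<Rightarrow> bit list" where
  "Z2_sum m B = map (\<lambda>i. \<Sum>a\<in>B. a ! i) [0..<m]"

definition neps :: "'v pair_pre_digraph list \<Rightarrow> bit list set \<Rightarrow> 'v list pair_pre_digraph" where
  "neps Gs B = \<lparr>pverts = listset (map pverts Gs),
     parcs = {(u, v). u \<in> listset (map pverts Gs) \<and> v \<in> listset (map pverts Gs) \<and>
       (\<exists>a\<in>B. \<forall>i<length Gs. (a ! i = 0 \<longrightarrow> u ! i = v ! i) \<and> (a ! i = 1 \<longrightarrow> (u ! i, v ! i) \<in> parcs (Gs ! i)))}\<rparr>"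

text \<open>Addition of a zero-one vector to a vertex, coordinate \<open>i\<close> being taken modulo \<open>ms ! i\<close>.\<close>

definition vertex_add :: "nat list \<Rightarrow> nat list \<Rightarrow> bit list \<Rightarrow> nat list" where
  "vertex_add ms u a = map (\<lambda>i. (u ! i + of_bit (a ! i)) mod (ms ! i)) [0..<length ms]"

end

theory Submission
  imports Defs
begin

text \<open>
  Every element of \<open>A\<close> acts on the vertices by flipping binary coordinates, so the adjacency matrix is
  a sum of commuting translations of \<open>Z_2^r\<close> and the characters \<open>\<chi>_S\<close> diagonalise it, with
  eigenvalues \<open>\<Sum>a\<in>A. \<chi>_S(a)\<close>. As \<open>exp (- \<i> x \<pi> / 2) = - \<i> x\<close> for \<open>x = \<plusminus>1\<close>, at time \<open>\<pi> / 2\<close> the eigenvalue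
  of the transition matrix is \<open>(- \<i>)^|A| \<Prod>a\<in>A. \<chi>_S(a) = (- \<i>)^|A| \<chi>_S(c)\<close>, which is the
  eigenvalue of \<open>(- \<i>)^|A|\<close> times the translation by \<open>c\<close>. In lexicographic order that translation
  is the stated Kronecker product.
\<close>

section \<open>Lexicographic enumeration of tuples\<close>

text \<open>Mixed-radix expansion with the most significant digit first. Quotient and remainder are
  split exactly as in \<open>kron\<close>, so the same digits describe tuples in lexicographic order
  and indices into Kronecker products.\<close>

primrec digits :: "nat list \<Rightarrow> nat \<Rightarrow> nat list" where
  "digits [] i = []"
| "digits (m # ms) i = (i div prod_list ms) # digits ms (i mod prod_list ms)"

definition box :: "nat list \<Rightarrow> nat list set" where
  "box ms = {u. length u = length ms \<and> (\<forall>i<length ms. u ! i < ms ! i)}"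

lemma Cons_box: "u \<in> box (m # ms) \<longleftrightarrow> (\<exists>x xs. u = x # xs \<and> x < m \<and> xs \<in> box ms)"
  by (cases u) (auto simp: box_def nth_Cons less_Suc_eq_0_disj split: nat.splits)

lemma listset_eq_box: "listset (map (\<lambda>n. {0..<n}) ms) = box ms"
proof (induction ms)
  case Nil
  then show ?case by (auto simp: box_def)
next
  case (Cons m ms)
  then show ?case
    by (auto simp: set_Cons_def Cons_box)
qed

lemma length_digits [simp]: "length (digits ms i) = length ms"
  by (induction ms arbitrary: i) auto

lemma prod_list_mod_less:
  assumes "i < m * prod_list ms" shows "i mod prod_list ms < prod_list (ms :: nat list)"
  using assms by (cases "prod_list ms = 0") (auto intro: mod_less_divisor)

lemma digits_in_box: "i < prod_list ms \<Longrightarrow> digits ms i \<in> box ms"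
proof (induction ms arbitrary: i)
  case Nil
  then show ?case by (simp add: box_def)
next
  case (Cons m ms)
  then show ?case
    by (auto simp: Cons_box prod_list_mod_less less_mult_imp_div_less)
qed

text \<open>Quotients of i < j are weakly ordered, and equal quotients force strictly ordered
  remainders; this is precisely lexicographic comparison of head and tail.\<close>

lemma digits_strict_mono:
  "i < j \<Longrightarrow> j < prod_list ms \<Longrightarrow> digits ms i < digits ms j"
proof (induction ms arbitrary: i j)
  case Nil
  then show ?case by simp
next
  case (Cons m ms)
  let ?L = "prod_list ms"
  have "i div ?L \<le> j div ?L" using Cons.prems by (simp add: div_le_mono)
  moreover have "i mod ?L < j mod ?L" if "i div ?L = j div ?L"
    using Cons.prems(1) that
    by (metis div_mult_mod_eq nat_add_left_cancel_less)
  ultimately show ?case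
    using Cons.IH Cons.prems prod_list_mod_less[of j m ms] by (auto simp: le_less)
qed

lemma digits_inj_iff:
  "i < prod_list ms \<Longrightarrow> j < prod_list ms \<Longrightarrow> digits ms i = digits ms j \<longleftrightarrow> i = j"
  using digits_strict_mono[of i j ms] digits_strict_mono[of j i ms]
  by (cases i j rule: linorder_cases) auto

lemma digits_image: "digits ms ` {..<prod_list ms} = box ms"
proof (intro equalityI subsetI)
  show "u \<in> digits ms ` {..<prod_list ms}" if "u \<in> box ms" for u
    using that
  proof (induction ms arbitrary: u)
    case Nil
    then show ?case by (auto simp: box_def)
  next
    case (Cons m ms)
    then obtain x xs where u: "u = x # xs" "x < m" "xs \<in> box ms" by (auto simp: Cons_box)
    with Cons.IH obtain i where i: "i < prod_list ms" "xs = digits ms i" by blast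
    have "x * prod_list ms + i < Suc x * prod_list ms" using i by simp
    also have "\<dots> \<le> m * prod_list ms" using u by (intro mult_right_mono) auto
    finally have "x * prod_list ms + i < prod_list (m # ms)" by simp
    moreover have "u = digits (m # ms) (x * prod_list ms + i)"
      using u i by simp
    ultimately show ?case by blast
  qed
qed (auto intro: digits_in_box)

text \<open>A strictly increasing list is determined by its set of elements. This makes the abstract
  vertex numbering explicit: the vertex with index i is \<open>digits ms i\<close>.\<close>

lemma sorted_list_of_box:
  "sorted_list_of_set (box ms) = map (digits ms) [0..<prod_list ms]"
proof -
  have "sorted_wrt (<) (map (digits ms) [0..<prod_list ms])"
    by (simp add: sorted_wrt_iff_nth_less digits_strict_mono)
  moreover have "set (map (digits ms) [0..<prod_list ms]) = box ms"
    using digits_image[of ms] by (simp add: lessThan_atLeast0)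
  ultimately show ?thesis
    by (metis sorted_list_of_set.idem_if_sorted_distinct strict_sorted_iff)
qed

lemma finite_box [simp]: "finite (box ms)"
  using digits_image[of ms] by (metis finite_imageI finite_lessThan)

lemma card_box: "card (box ms) = prod_list ms"
proof -
  have "inj_on (digits ms) {..<prod_list ms}" by (auto simp: inj_on_def digits_inj_iff)
  then show ?thesis using card_image[of "digits ms" "{..<prod_list ms}"] by (simp add: digits_image)
qed

text \<open>Separates the complete-graph coordinates from the binary ones, in the way that
  \<open>kron\<close> separates the row index of its two factors.\<close>

lemma digits_append:
  assumes "i < prod_list (ms @ ms')"
  shows "digits (ms @ ms') i = digits ms (i div prod_list ms') @ digits ms' (i mod prod_list ms')"
  using assms
proof (induction ms arbitrary: i)
  case Nil
  then show ?case by simp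
next
  case (Cons m ms)
  let ?P = "prod_list ms" and ?Q = "prod_list ms'"
  have "i mod (?P * ?Q) < ?P * ?Q"
    using prod_list_mod_less[of i m "ms @ ms'"] Cons.prems by simp
  then have "digits (ms @ ms') (i mod (?P * ?Q)) =
      digits ms (i mod (?P * ?Q) div ?Q) @ digits ms' (i mod (?P * ?Q) mod ?Q)"
    by (simp add: Cons.IH)
  \<comment> \<open>Reducing modulo ?P * ?Q keeps the last remainder and reduces the quotient by ?Q
    modulo ?P, so stripping the head digit commutes with splitting off the tail block.\<close>
  moreover have "i mod (?P * ?Q) div ?Q = i div ?Q mod ?P"
    by (cases "?Q = 0") (simp_all add: mult.commute[of ?P] mod_mult2_eq)
  moreover have "i mod (?P * ?Q) mod ?Q = i mod ?Q"
    by (simp add: mod_mod_cancel)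
  moreover have "i div (?P * ?Q) = i div ?Q div ?P"
    by (metis div_mult2_eq mult.commute)
  ultimately show ?case by simp
qed

lemma all_less_add_iff: "(\<forall>l<m + n. P l) \<longleftrightarrow> (\<forall>l<m. P l) \<and> (\<forall>l<n. P (m + l))" for m n :: nat
proof (intro iffI allI impI)
  fix l assume *: "(\<forall>l<m. P l) \<and> (\<forall>l<n. P (m + l))" "l < m + n"
  show "P l"
  proof (cases "l < m")
    case False
    then have "l - m < n" "l = m + (l - m)" using *(2) by auto
    then show ?thesis using *(1) by metis
  qed (use * in auto)
qed auto

section \<open>Entries of Kronecker products\<close>

lemma kron_list_carrier:
  "\<forall>M\<in>set Ms. dim_col M = dim_row M \<Longrightarrow>
    kron_list Ms \<in> carrier_mat (prod_list (map dim_row Ms)) (prod_list (map dim_row Ms))"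
  by (induction Ms) (auto simp: kron_list_def kron_def)

text \<open>Each factor sees only its own digit of the row and column index, so the entry is a
  product over coordinates.\<close>

lemma kron_list_entry:
  assumes "\<forall>M\<in>set Ms. dim_col M = dim_row M"
    and "i < prod_list (map dim_row Ms)" "j < prod_list (map dim_row Ms)"
  shows "kron_list Ms $$ (i, j) =
    (\<Prod>l<length Ms. Ms ! l $$ (digits (map dim_row Ms) i ! l, digits (map dim_row Ms) j ! l))"
  using assms
proof (induction Ms arbitrary: i j)
  case Nil
  then show ?case by (simp add: kron_list_def)
next
  case (Cons M Ms)
  let ?L = "prod_list (map dim_row Ms)"
  have car: "kron_list Ms \<in> carrier_mat ?L ?L" using Cons.prems by (intro kron_list_carrier) auto
  have lt: "i mod ?L < ?L" "j mod ?L < ?L"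
    using Cons.prems prod_list_mod_less by auto
  have "kron_list (M # Ms) $$ (i, j) =
      M $$ (i div ?L, j div ?L) * kron_list Ms $$ (i mod ?L, j mod ?L)"
    using Cons.prems car by (simp add: kron_list_def kron_def)
  then show ?case
    using Cons.IH[OF _ lt] Cons.prems by (simp add: prod.lessThan_Suc_shift del: prod.lessThan_Suc)
qed

lemma pow_mat_Suc_entry:
  assumes "M \<in> carrier_mat n n" "i < n" "j < n"
  shows "(M ^\<^sub>m Suc k) $$ (i, j) = (\<Sum>l<n. (M ^\<^sub>m k) $$ (i, l) * M $$ (l, j))"
proof -
  have "M ^\<^sub>m k \<in> carrier_mat n n" using assms by simp
  then show ?thesis using assms by (simp add: scalar_prod_def lessThan_atLeast0)
qed

lemma adj_K2_power_carrier:
  "adj_mat (complete_graph 2) ^\<^sub>m k \<in> carrier_mat 2 2"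
  by (rule pow_carrier_mat) (simp add: adj_mat_def complete_graph_def)

text \<open>Power 0 is the identity and power 1 the swap, so both are the permutation matrix of
  adding \<open>b\<close> modulo 2.\<close>

lemma adj_K2_power_entry:
  assumes "x < 2" "y < 2"
  shows "(adj_mat (complete_graph 2) ^\<^sub>m of_bit b) $$ (x, y) =
    (if y = (x + of_bit b) mod 2 then 1 else 0)"
proof (cases b)
  case zero
  then show ?thesis using assms by (simp add: adj_mat_K2 mat_of_rows_list_def)
next
  case one
  have *: "adj_mat (complete_graph 2) \<in> carrier_mat 2 2"
    by (simp add: adj_mat_def complete_graph_def)
  show ?thesis using assms * one
    by (auto simp: adj_mat_K2 mat_of_rows_list_def less_2_cases_iff)
qed

section \<open>Characters\<close>

text \<open>Characters of the binary cube, evaluated on natural-number representatives of bits so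
  that they apply to vertices as well as to vectors of \<open>A\<close>. They are real, hence no
  conjugate appears in the orthogonality relation.\<close>

definition chi :: "nat set \<Rightarrow> nat list \<Rightarrow> complex" where
  "chi S u = (\<Prod>i\<in>S. (- 1) ^ (u ! i))"

lemma chi_cases: "chi S u = 1 \<or> chi S u = - 1"
proof (induction S rule: infinite_finite_induct)
  case (insert i S)
  then show ?case using neg_one_even_power[of "u ! i", where 'a = complex]
      neg_one_odd_power[of "u ! i", where 'a = complex]
    by (cases "even (u ! i)") (auto simp: chi_def)
qed (auto simp: chi_def)

lemma minus_one_power_sum_bit:
  "(- 1 :: complex) ^ of_bit (\<Sum>a\<in>B. f a) = (\<Prod>a\<in>B. (- 1) ^ of_bit (f a))"
proof (induction B rule: infinite_finite_induct)
  case (insert x B)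
  have "(- 1 :: complex) ^ of_bit (a + b) = (- 1) ^ of_bit a * (- 1) ^ of_bit b" for a b
    by (cases a; cases b) auto
  then show ?case using insert by simp
qed auto

lemma chi_orthogonality:
  assumes "finite I"
  shows "(\<Sum>S\<in>Pow I. chi S u * chi S v) = (if \<forall>i\<in>I. even (u ! i + v ! i) then 2 ^ card I else 0)"
proof -
  have "(\<Sum>S\<in>Pow I. chi S u * chi S v) = (\<Sum>S\<in>Pow I. \<Prod>i\<in>S. (- 1) ^ (u ! i + v ! i))"
    by (simp add: chi_def power_add prod.distrib)
  \<comment> \<open>Expanding a product of binomials x_i + 1 gives the sum over all subsets S of the
    products of x_i over S. A factor is 2 when the digit sum is even and 0 when it is odd.\<close>
  also have "\<dots> = (\<Prod>i\<in>I. (- 1) ^ (u ! i + v ! i) + 1)"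
    using assms by (subst prod_add) auto
  also have "\<dots> = (if \<forall>i\<in>I. even (u ! i + v ! i) then 2 ^ card I else 0)"
  proof (cases "\<forall>i\<in>I. even (u ! i + v ! i)")
    case True
    then have "(\<Prod>i\<in>I. (- 1 :: complex) ^ (u ! i + v ! i) + 1) = (\<Prod>i\<in>I. 2)"
      by (intro prod.cong) auto
    then show ?thesis using True by simp
  next
    case False
    then obtain i where i: "i \<in> I" "odd (u ! i + v ! i)" by blast
    then have "(- 1 :: complex) ^ (u ! i + v ! i) + 1 = 0"
      by (subst neg_one_odd_power) auto
    with i(1) assms have "(\<Prod>i\<in>I. (- 1 :: complex) ^ (u ! i + v ! i) + 1) = 0"
      by (intro prod_zero) auto
    then show ?thesis using False by argo
  qed
  finally show ?thesis .
qed

lemma exp_quarter_turn: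
  assumes "x = 1 \<or> x = - 1"
  shows "exp (- \<i> * complex_of_real (pi / 2) * x) = - \<i> * x"
  using assms by (auto simp: exp_eq_polar cis_mult)

section \<open>The transition matrix\<close>

locale cubelike_neps =
  fixes ns :: "nat list" and r :: nat and A :: "bit list set"
  assumes length_A: "a \<in> A \<Longrightarrow> length a = length ns + r"
    and A_nth_eq_0: "a \<in> A \<Longrightarrow> i < length ns \<Longrightarrow> a ! i = 0"
begin

abbreviation "d \<equiv> length ns"
abbreviation "ms \<equiv> ns @ replicate r 2"
abbreviation "G \<equiv> neps (map complete_graph ms) A"
abbreviation "I \<equiv> {d..<d + r}"
abbreviation "N \<equiv> prod_list ms"

text \<open>The subgroup that contains \<open>A\<close> and its sum c. Its elements move only binary
  coordinates, so they act on the vertices by involutive translations.\<close>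

definition shifts :: "bit list set" where
  "shifts = {a. length a = d + r \<and> (\<forall>i<d. a ! i = 0)}"

definition eigenvalue :: "nat set \<Rightarrow> complex" where
  "eigenvalue S = (\<Sum>a\<in>A. chi S (map of_bit a))"

lemma A_shifts: "a \<in> A \<Longrightarrow> a \<in> shifts"
  by (auto simp: shifts_def length_A A_nth_eq_0)

lemma finite_A: "finite A"
proof (rule finite_subset)
  show "A \<subseteq> {a. set a \<subseteq> UNIV \<and> length a = d + r}" using length_A by auto
  have "finite (UNIV :: bit set)" by (rule finite_subset[of _ "{0, 1}"]) (auto simp: bit_not_zero_iff)
  then show "finite {a :: bit list. set a \<subseteq> UNIV \<and> length a = d + r}"
    by (rule finite_lists_length_eq)
qed

section \<open>Translations of the vertex set\<close>

lemma pverts_G: "pverts G = box ms"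
  by (simp add: neps_def complete_graph_def comp_def flip: listset_eq_box)

lemma vertex_list_G: "vertex_list G = map (digits ms) [0..<N]"
  by (simp only: vertex_list_def pverts_G sorted_list_of_box)

lemma length_vertex_add [simp]: "length (vertex_add ms u a) = d + r"
  by (simp add: vertex_add_def)

lemma vertex_add_nth_low:
  assumes "a \<in> shifts" "u \<in> box ms" "i < d"
  shows "vertex_add ms u a ! i = u ! i"
proof -
  have "u ! i < ms ! i" using assms by (simp add: box_def)
  then show ?thesis using assms by (simp add: vertex_add_def shifts_def nth_append)
qed

lemma vertex_add_nth_high:
  assumes "i \<in> I"
  shows "vertex_add ms u a ! i = (u ! i + of_bit (a ! i)) mod 2"
  using assms by (auto simp: vertex_add_def nth_append)

lemma box_nth_high: "u \<in> box ms \<Longrightarrow> i \<in> I \<Longrightarrow> u ! i < 2"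
  by (auto simp: box_def nth_append split: if_splits dest!: spec[of _ i])

lemma vertex_add_in_box:
  assumes "a \<in> shifts" "u \<in> box ms"
  shows "vertex_add ms u a \<in> box ms"
proof -
  have "vertex_add ms u a ! i < ms ! i" if "i < d + r" for i
  proof (cases "i < d")
    case True
    then show ?thesis using assms by (simp add: vertex_add_nth_low) (simp add: box_def)
  next
    case False
    then show ?thesis using that by (simp add: vertex_add_nth_high nth_append)
  qed
  then show ?thesis by (simp add: box_def)
qed

text \<open>Binary digits agree exactly when their sum is even; this is the condition under which
  the character sum in \<open>chi_orthogonality\<close> does not vanish.\<close>

lemma box_eq_iff:
  assumes "u \<in> box ms" "v \<in> box ms"
  shows "u = v \<longleftrightarrow> (\<forall>i<d. u ! i = v ! i) \<and> (\<forall>i\<in>I. even (u ! i + v ! i))"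
proof
  assume *: "(\<forall>i<d. u ! i = v ! i) \<and> (\<forall>i\<in>I. even (u ! i + v ! i))"
  have "u ! i = v ! i" if "i < d + r" for i
  proof (cases "i < d")
    case False
    then have "i \<in> I" using that by simp
    then have "u ! i < 2" "v ! i < 2" "even (u ! i + v ! i)"
      using * assms box_nth_high by auto
    then show ?thesis by (auto simp: less_2_cases_iff)
  qed (use * in auto)
  then show "u = v" using assms by (auto simp: box_def intro: nth_equalityI)
qed auto

text \<open>A power of -1 depends only on the parity of its exponent, so reduction modulo 2 is
  harmless on the coordinates in S and the character is multiplicative.\<close>

lemma chi_vertex_add:
  assumes "S \<subseteq> I" "length a = d + r"
  shows "chi S (vertex_add ms u a) = chi S u * chi S (map of_bit a)"
  unfolding chi_def prod.distrib[symmetric]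
proof (rule prod.cong[OF refl])
  fix i assume "i \<in> S"
  then have i: "i \<in> I" using assms by auto
  have "(- 1 :: complex) ^ (n mod 2) = (- 1) ^ n" for n
    by (cases "even n") (auto simp: odd_iff_mod_2_eq_one)
  then show "(- 1 :: complex) ^ (vertex_add ms u a ! i) = (- 1) ^ (u ! i) * (- 1) ^ (map of_bit a ! i)"
    using i assms by (simp add: vertex_add_nth_high power_add)
qed

text \<open>The translations act freely. Hence distinct elements of \<open>A\<close> lead to
  distinct neighbours, and a sum over neighbours is a sum over \<open>A\<close> without
  multiplicities.\<close>

lemma vertex_add_inj:
  assumes "a \<in> shifts" "b \<in> shifts" "vertex_add ms u a = vertex_add ms u b"
  shows "a = b"
proof (rule nth_equalityI)
  fix i assume "i < length a"
  show "a ! i = b ! i"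
  proof (cases "i < d")
    case False
    then have i: "i \<in> I" using \<open>i < length a\<close> assms by (simp add: shifts_def)
    then have "(u ! i + of_bit (a ! i)) mod 2 = (u ! i + of_bit (b ! i)) mod 2"
      using vertex_add_nth_high assms(3) by metis
    then show ?thesis
      by (cases "a ! i"; cases "b ! i") (auto simp: mod_Suc split: if_splits)
  qed (use assms in \<open>auto simp: shifts_def\<close>)
qed (use assms in \<open>auto simp: shifts_def\<close>)

text \<open>An element a of \<open>A\<close> vanishes on the complete-graph coordinates and so
  demands equality there. In a binary coordinate, adjacency in K_2 means a flipped digit. Together
  the conditions single out the translate of v by a.\<close>

lemma parcs_G_iff:
  assumes "w \<in> box ms" "v \<in> box ms"
  shows "(w, v) \<in> parcs G \<longleftrightarrow> w \<in> vertex_add ms v ` A"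
proof -
  have "(\<forall>i<d + r. (a ! i = 0 \<longrightarrow> w ! i = v ! i) \<and>
          (a ! i = 1 \<longrightarrow> (w ! i, v ! i) \<in> parcs (complete_graph (ms ! i)))) \<longleftrightarrow>
        w = vertex_add ms v a" (is "(\<forall>i<_. ?P i) \<longleftrightarrow> _") if "a \<in> A" for a
  proof -
    have a: "a \<in> shifts" using that by (rule A_shifts)
    have "?P i \<longleftrightarrow> w ! i = vertex_add ms v a ! i" if i: "i < d + r" for i
    proof (cases "i < d")
      case True
      then show ?thesis using a assms by (simp add: vertex_add_nth_low) (simp add: shifts_def)
    next
      case False
      then have "i \<in> I" using i by simp
      then have "w ! i < 2" "v ! i < 2" "ms ! i = 2"
        using assms box_nth_high by (auto simp: nth_append)
      then show ?thesis using \<open>i \<in> I\<close>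
        by (cases "a ! i") (auto simp: vertex_add_nth_high complete_graph_def less_2_cases_iff)
    qed
    then show ?thesis
      using assms by (auto simp: box_def list_eq_iff_nth_eq)
  qed
  note iff = this
  have "(w, v) \<in> parcs G \<longleftrightarrow> (\<exists>a\<in>A. \<forall>i<d + r. (a ! i = 0 \<longrightarrow> w ! i = v ! i) \<and>
          (a ! i = 1 \<longrightarrow> (w ! i, v ! i) \<in> parcs (complete_graph (ms ! i))))"
    using assms pverts_G by (auto simp: neps_def simp del: map_append)
  also have "\<dots> \<longleftrightarrow> w \<in> vertex_add ms v ` A"
    using iff by blast
  finally show ?thesis .
qed

section \<open>The adjacency matrix and its spectral expansion\<close>

lemma adj_mat_G_carrier: "adj_mat G \<in> carrier_mat N N"
  unfolding adj_mat_def pverts_G card_box by simp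

lemma adj_mat_G_entry:
  assumes "i < N" "j < N"
  shows "adj_mat G $$ (i, j) = (if digits ms i \<in> vertex_add ms (digits ms j) ` A then 1 else 0)"
  unfolding adj_mat_def pverts_G card_box
  using assms by (simp only: index_mat case_prod_conv vertex_list_G nth_map length_upt nth_upt
      diff_zero add_0 parcs_G_iff digits_in_box)

text \<open>Right multiplication by the adjacency matrix replaces a function of the column vertex by
  the sum of its translates; this is what the induction on matrix powers consumes.\<close>

lemma sum_adj_column:
  assumes "j < N"
  shows "(\<Sum>l<N. f (digits ms l) * adj_mat G $$ (l, j)) = (\<Sum>a\<in>A. f (vertex_add ms (digits ms j) a))"
proof -
  let ?v = "digits ms j"
  have v: "?v \<in> box ms" using assms by (rule digits_in_box)
  have "(\<Sum>l<N. f (digits ms l) * adj_mat G $$ (l, j)) =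
      (\<Sum>l<N. f (digits ms l) * (if digits ms l \<in> vertex_add ms ?v ` A then 1 else 0))"
    using assms by (intro sum.cong) (auto simp only: adj_mat_G_entry lessThan_iff)
  also have "\<dots> = (\<Sum>w\<in>box ms. f w * (if w \<in> vertex_add ms ?v ` A then 1 else 0))"
    unfolding digits_image[symmetric]
    by (subst sum.reindex) (auto simp only: inj_on_def digits_inj_iff lessThan_iff comp_def)
  also have "\<dots> = (\<Sum>w\<in>box ms \<inter> vertex_add ms ?v ` A. f w)"
    by (subst sum.inter_restrict) (auto intro!: sum.cong)
  also have "box ms \<inter> vertex_add ms ?v ` A = vertex_add ms ?v ` A"
    using v A_shifts vertex_add_in_box by blast
  also have "(\<Sum>w\<in>vertex_add ms ?v ` A. f w) = (\<Sum>a\<in>A. f (vertex_add ms ?v a))"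
    using A_shifts vertex_add_inj by (subst sum.reindex) (auto simp: inj_on_def)
  finally show ?thesis .
qed

text \<open>The (u, v) entry of the matrix that is the identity on the complete-graph coordinates
  and has eigenvalue \<open>g S\<close> on the character \<open>chi S\<close> of the binary ones.
  Each character has squared norm 2^r on the cube, whence the division.\<close>

definition spectral_sum :: "(nat set \<Rightarrow> complex) \<Rightarrow> nat list \<Rightarrow> nat list \<Rightarrow> complex" where
  "spectral_sum g u v =
    (if \<forall>i<d. u ! i = v ! i then (\<Sum>S\<in>Pow I. g S * (chi S u * chi S v)) / 2 ^ r else 0)"

lemma spectral_sum_one:
  assumes "u \<in> box ms" "v \<in> box ms"
  shows "spectral_sum (\<lambda>S. 1) u v = (if u = v then 1 else 0)"
  using assms chi_orthogonality[of I u v] box_eq_iff[OF assms] by (auto simp: spectral_sum_def)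

text \<open>A translation is diagonal in the character basis: it multiplies the coefficient of
  \<open>chi S\<close> by the value of the character at a.\<close>

lemma spectral_sum_vertex_add:
  assumes "a \<in> shifts" "v \<in> box ms"
  shows "spectral_sum g u (vertex_add ms v a) = spectral_sum (\<lambda>S. g S * chi S (map of_bit a)) u v"
proof -
  have "chi S (vertex_add ms v a) = chi S v * chi S (map of_bit a)" if "S \<in> Pow I" for S
    using that assms by (intro chi_vertex_add) (auto simp: shifts_def)
  then have "(\<Sum>S\<in>Pow I. g S * (chi S u * chi S (vertex_add ms v a))) =
      (\<Sum>S\<in>Pow I. g S * chi S (map of_bit a) * (chi S u * chi S v))"
    by (intro sum.cong) (auto simp: mult_ac)
  then show ?thesis
    using assms by (auto simp: spectral_sum_def vertex_add_nth_low)
qed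

lemma spectral_sum_sum:
  "(\<Sum>a\<in>B. spectral_sum (g a) u v) = spectral_sum (\<lambda>S. \<Sum>a\<in>B. g a S) u v"
proof -
  have "(\<Sum>a\<in>B. \<Sum>S\<in>Pow I. g a S * (chi S u * chi S v)) =
      (\<Sum>S\<in>Pow I. (\<Sum>a\<in>B. g a S) * (chi S u * chi S v))"
    unfolding sum_distrib_right by (rule sum.swap)
  moreover have "(\<Sum>a\<in>B. if P then f a else 0) = (if P then sum f B else 0)" for P and f :: "_ \<Rightarrow> complex"
    by simp
  ultimately show ?thesis
    by (simp only: spectral_sum_def flip: sum_divide_distrib)
qed

lemma spectral_sum_cmult: "z * spectral_sum g u v = spectral_sum (\<lambda>S. z * g S) u v"
  by (auto simp: spectral_sum_def sum_distrib_left mult.assoc)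

lemma spectral_sum_divide: "spectral_sum g u v / z = spectral_sum (\<lambda>S. g S / z) u v"
  using spectral_sum_cmult[of "inverse z" g u v] by (simp add: divide_inverse mult.commute)

lemma adj_power_entry:
  assumes "i < N" "j < N"
  shows "((z \<cdot>\<^sub>m adj_mat G) ^\<^sub>m k) $$ (i, j) =
    spectral_sum (\<lambda>S. (z * eigenvalue S) ^ k) (digits ms i) (digits ms j)"
  using assms
\<comment> \<open>The column varies because the product for the next power runs over intermediate
  columns l. Translating by each a in \<open>A\<close> contributes its character value, and these
  add up to \<open>eigenvalue S\<close>.\<close>
proof (induction k arbitrary: j)
  case 0
  have "((z \<cdot>\<^sub>m adj_mat G) ^\<^sub>m 0) $$ (i, j) = (if i = j then 1 else 0)"
    using 0 adj_mat_G_carrier by auto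
  also have "\<dots> = spectral_sum (\<lambda>S. 1) (digits ms i) (digits ms j)"
    using 0 by (subst spectral_sum_one) (auto simp only: digits_in_box digits_inj_iff)
  finally show ?case by (simp only: power_0)
next
  case (Suc k)
  let ?u = "digits ms i" and ?v = "digits ms j"
  have v: "?v \<in> box ms" using Suc.prems by (intro digits_in_box)
  have M: "z \<cdot>\<^sub>m adj_mat G \<in> carrier_mat N N" using adj_mat_G_carrier by (rule smult_carrier_mat)
  have Mk: "(z \<cdot>\<^sub>m adj_mat G) ^\<^sub>m k \<in> carrier_mat N N" using M by (rule pow_carrier_mat)
  have "((z \<cdot>\<^sub>m adj_mat G) ^\<^sub>m Suc k) $$ (i, j) =
      (\<Sum>l<N. ((z \<cdot>\<^sub>m adj_mat G) ^\<^sub>m k) $$ (i, l) * (z \<cdot>\<^sub>m adj_mat G) $$ (l, j))"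
    using M Suc.prems by (rule pow_mat_Suc_entry)
  also have "\<dots> = (\<Sum>l<N. z * spectral_sum (\<lambda>S. (z * eigenvalue S) ^ k) ?u (digits ms l) *
      adj_mat G $$ (l, j))"
  proof (rule sum.cong[OF refl])
    fix l assume "l \<in> {..<N}"
    then have l: "l < N" by (simp only: lessThan_iff)
    then have "(z \<cdot>\<^sub>m adj_mat G) $$ (l, j) = z * adj_mat G $$ (l, j)"
      using adj_mat_G_carrier Suc.prems by (intro index_smult_mat) (auto simp only: carrier_matD)
    then show "((z \<cdot>\<^sub>m adj_mat G) ^\<^sub>m k) $$ (i, l) * (z \<cdot>\<^sub>m adj_mat G) $$ (l, j) =
      z * spectral_sum (\<lambda>S. (z * eigenvalue S) ^ k) ?u (digits ms l) * adj_mat G $$ (l, j)"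
      by (simp only: Suc.IH[OF Suc.prems(1) l] mult_ac)
  qed
  also have "\<dots> = (\<Sum>a\<in>A. z * spectral_sum (\<lambda>S. (z * eigenvalue S) ^ k) ?u (vertex_add ms ?v a))"
    by (rule sum_adj_column[OF Suc.prems(2)])
  also have "\<dots> = (\<Sum>a\<in>A. spectral_sum (\<lambda>S. z * ((z * eigenvalue S) ^ k * chi S (map of_bit a))) ?u ?v)"
    using v A_shifts by (intro sum.cong) (simp_all only: spectral_sum_vertex_add spectral_sum_cmult)
  also have "\<dots> = spectral_sum (\<lambda>S. (z * eigenvalue S) ^ Suc k) ?u ?v"
  proof -
    have "(\<Sum>a\<in>A. z * ((z * eigenvalue S) ^ k * chi S (map of_bit a))) = (z * eigenvalue S) ^ Suc k" for S
      unfolding sum_distrib_left[symmetric] eigenvalue_def[symmetric] by (simp add: mult_ac)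
    then show ?thesis by (simp only: spectral_sum_sum)
  qed
  finally show ?case .
qed

text \<open>Only finitely many subsets S occur, so the exponential series may be summed separately
  on each eigenvalue.\<close>

lemma spectral_sum_sums:
  assumes "\<And>S. S \<subseteq> I \<Longrightarrow> (\<lambda>k. g k S) sums h S"
  shows "(\<lambda>k. spectral_sum (g k) u v) sums spectral_sum h u v"
proof (cases "\<forall>i<d. u ! i = v ! i")
  case True
  then show ?thesis
    using assms by (auto simp: spectral_sum_def intro!: sums_divide sums_sum sums_mult2)
next
  case False
  then have "spectral_sum g u v = 0" for g by (auto simp: spectral_sum_def)
  then show ?thesis by simp
qed

section \<open>The exponential at a quarter turn\<close>

lemma transition_mat_G_carrier: "transition_mat G t \<in> carrier_mat N N"
  using carrier_matD(1)[OF adj_mat_G_carrier]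
  by (simp add: transition_mat_def mat_exp_def)

lemma exp_eigenvalue:
  assumes "S \<subseteq> I"
  shows "exp (- \<i> * complex_of_real (pi / 2) * eigenvalue S) =
    (- \<i>) ^ card A * chi S (map of_bit (Z2_sum (d + r) A))"
proof -
  have "exp (- \<i> * complex_of_real (pi / 2) * eigenvalue S) =
      (\<Prod>a\<in>A. exp (- \<i> * complex_of_real (pi / 2) * chi S (map of_bit a)))"
    unfolding eigenvalue_def sum_distrib_left by (rule exp_sum[OF finite_A])
  also have "\<dots> = (\<Prod>a\<in>A. - \<i> * chi S (map of_bit a))"
    by (intro prod.cong refl exp_quarter_turn chi_cases)
  also have "\<dots> = (- \<i>) ^ card A * (\<Prod>a\<in>A. chi S (map of_bit a))"
    by (simp only: prod.distrib prod_constant)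
  also have "(\<Prod>a\<in>A. chi S (map of_bit a)) = chi S (map of_bit (Z2_sum (d + r) A))"
  proof -
    \<comment> \<open>With the coordinate i fixed first, the signs of all a in \<open>A\<close>
      multiply to the sign of the i-th coordinate of their sum over the two-element field.\<close>
    have "(\<Prod>a\<in>A. chi S (map of_bit a)) = (\<Prod>i\<in>S. \<Prod>a\<in>A. (- 1) ^ (map of_bit a ! i))"
      unfolding chi_def by (rule prod.swap)
    also have "\<dots> = chi S (map of_bit (Z2_sum (d + r) A))"
      unfolding chi_def
    proof (rule prod.cong[OF refl])
      fix i assume "i \<in> S"
      then have i: "i < d + r" using assms by auto
      have "(\<Prod>a\<in>A. (- 1 :: complex) ^ (map of_bit a ! i)) = (\<Prod>a\<in>A. (- 1) ^ of_bit (a ! i))"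
        using i length_A by (intro prod.cong) auto
      also have "\<dots> = (- 1) ^ (map of_bit (Z2_sum (d + r) A) ! i)"
        using i by (simp only: Z2_sum_def nth_map length_map length_upt nth_upt diff_zero add_0
            minus_one_power_sum_bit)
      finally show "(\<Prod>a\<in>A. (- 1 :: complex) ^ (map of_bit a ! i)) = \<dots>" .
    qed
    finally show ?thesis .
  qed
  finally show ?thesis .
qed

lemma Z2_sum_shifts: "Z2_sum (d + r) A \<in> shifts"
  by (simp add: shifts_def Z2_sum_def A_nth_eq_0)

lemma transition_mat_G_entry:
  assumes "i < N" "j < N"
  shows "transition_mat G (pi / 2) $$ (i, j) =
    (if digits ms j = vertex_add ms (digits ms i) (Z2_sum (d + r) A) then (- \<i>) ^ card A else 0)"
proof -
  let ?u = "digits ms i" and ?v = "digits ms j" and ?c = "Z2_sum (d + r) A"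
  let ?z = "- \<i> * complex_of_real (pi / 2)"
  have uv: "?u \<in> box ms" "?v \<in> box ms" using assms by (auto intro: digits_in_box)
  have "transition_mat G (pi / 2) $$ (i, j) = (\<Sum>k. ((?z \<cdot>\<^sub>m adj_mat G) ^\<^sub>m k) $$ (i, j) / fact k)"
    unfolding transition_mat_def mat_exp_def
    using assms carrier_matD(1)[OF adj_mat_G_carrier] by (simp del: prod_list.append)
  also have "\<dots> = (\<Sum>k. spectral_sum (\<lambda>S. (?z * eigenvalue S) ^ k / fact k) ?u ?v)"
    by (simp only: adj_power_entry[OF assms] spectral_sum_divide)
  also have "\<dots> = spectral_sum (\<lambda>S. exp (?z * eigenvalue S)) ?u ?v"
  proof (intro sums_unique[symmetric] spectral_sum_sums)
    have "(\<lambda>k. x ^ k / fact k) sums exp x" for x :: complex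
      using exp_converges[of x] by (simp add: scaleR_conv_of_real divide_inverse mult.commute)
    then show "(\<lambda>k. (?z * eigenvalue S) ^ k / fact k) sums exp (?z * eigenvalue S)" for S .
  qed
  also have "\<dots> = spectral_sum (\<lambda>S. (- \<i>) ^ card A * chi S (map of_bit ?c)) ?u ?v"
    unfolding spectral_sum_def
    by (intro if_cong refl arg_cong2[where f = "(/)"] sum.cong) (simp only: exp_eigenvalue Pow_iff)
  also have "\<dots> = (- \<i>) ^ card A * spectral_sum (\<lambda>S. chi S (map of_bit ?c)) ?u ?v"
    by (rule spectral_sum_cmult[symmetric])
  \<comment> \<open>The kernel is symmetric in its two vertices. Exchanging them puts ?u in the
    second argument, where the character of ?c can be absorbed as a translation; the remaining
    coefficient 1 gives the identity matrix.\<close>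
  also have "spectral_sum (\<lambda>S. chi S (map of_bit ?c)) ?u ?v = spectral_sum (\<lambda>S. chi S (map of_bit ?c)) ?v ?u"
    by (auto simp: spectral_sum_def mult_ac)
  also have "\<dots> = spectral_sum (\<lambda>S. 1) ?v (vertex_add ms ?u ?c)"
    using spectral_sum_vertex_add[OF Z2_sum_shifts uv(1), of "\<lambda>S. 1"] by simp
  also have "\<dots> = (if ?v = vertex_add ms ?u ?c then 1 else 0)"
    using uv vertex_add_in_box Z2_sum_shifts by (intro spectral_sum_one)
  finally show ?thesis by auto
qed

section \<open>Translation by c as a Kronecker product\<close>

abbreviation kron_shift :: "bit list \<Rightarrow> complex mat" where
  "kron_shift c \<equiv> 1\<^sub>m (prod_list ns) \<otimes>\<^sub>K
    kron_list (map (\<lambda>j. adj_mat (complete_graph 2) ^\<^sub>m of_bit (c ! j)) [d..<d + r])"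

text \<open>The identity factor compares all complete-graph digits at once, and each power of the
  K_2 matrix compares one binary digit with its translate. The product of these indicators is the
  indicator of their conjunction.\<close>

lemma kron_shift_carrier_entry:
  assumes "c \<in> shifts"
  shows "kron_shift c \<in> carrier_mat N N"
    and "i < N \<Longrightarrow> j < N \<Longrightarrow> kron_shift c $$ (i, j) =
      (if digits ms j = vertex_add ms (digits ms i) c then 1 else 0)"
proof -
  define Ms where "Ms = map (\<lambda>j. adj_mat (complete_graph 2) ^\<^sub>m of_bit (c ! j)) [d..<d + r]"
  let ?rs = "replicate r (2 :: nat)"
  let ?R = "prod_list ?rs"
  have dims: "map dim_row Ms = ?rs"
    unfolding Ms_def map_map comp_def carrier_matD(1)[OF adj_K2_power_carrier]
    by (simp add: map_replicate_const)
  have square: "\<forall>M\<in>set Ms. dim_col M = dim_row M"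
    unfolding Ms_def
    by (auto simp only: set_map carrier_matD[OF adj_K2_power_carrier])
  have K: "kron_list Ms \<in> carrier_mat ?R ?R"
    using kron_list_carrier[OF square] by (simp only: dims)
  show carrier: "kron_shift c \<in> carrier_mat N N"
    unfolding Ms_def[symmetric] using K by (simp add: kron_def)
  assume ij: "i < N" "j < N"
  let ?u = "digits ms i" and ?v = "digits ms j"
  have div: "i div ?R < prod_list ns" "j div ?R < prod_list ns"
    using ij by (auto intro: less_mult_imp_div_less)
  have mod: "i mod ?R < ?R" "j mod ?R < ?R" by simp_all
  have uv: "?u \<in> box ms" "?v \<in> box ms" using ij by (auto intro: digits_in_box)
  \<comment> \<open>Here ?R is 2^r: the quotient of an index by ?R encodes the complete-graph
    coordinates and the remainder the binary ones.\<close>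
  have split: "?u = digits ns (i div ?R) @ digits ?rs (i mod ?R)"
    "?v = digits ns (j div ?R) @ digits ?rs (j mod ?R)"
    using ij by (simp_all only: digits_append)
  have "kron_shift c $$ (i, j) =
      (if i div ?R = j div ?R then 1 else 0) * kron_list Ms $$ (i mod ?R, j mod ?R)"
    unfolding Ms_def[symmetric] using K ij div by (simp add: kron_def)
  also have "kron_list Ms $$ (i mod ?R, j mod ?R) =
      (\<Prod>l<r. if ?v ! (d + l) = vertex_add ms ?u c ! (d + l) then 1 else 0)"
  proof -
    have "kron_list Ms $$ (i mod ?R, j mod ?R) =
        (\<Prod>l<length Ms. Ms ! l $$ (digits ?rs (i mod ?R) ! l, digits ?rs (j mod ?R) ! l))"
      using kron_list_entry[OF square, unfolded dims, OF mod] .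
    also have "\<dots> = (\<Prod>l<r. if ?v ! (d + l) = vertex_add ms ?u c ! (d + l) then 1 else 0)"
    proof (rule prod.cong)
      fix l assume "l \<in> {..<r}"
      then have l: "l < r" "d + l \<in> I" by auto
      have nth: "digits ?rs (i mod ?R) ! l = ?u ! (d + l)" "digits ?rs (j mod ?R) ! l = ?v ! (d + l)"
        unfolding split by (simp_all add: nth_append)
      have "Ms ! l = adj_mat (complete_graph 2) ^\<^sub>m of_bit (c ! (d + l))"
        using l by (simp only: Ms_def nth_map length_upt nth_upt diff_add_inverse nat_add_left_cancel_less)
      then show "Ms ! l $$ (digits ?rs (i mod ?R) ! l, digits ?rs (j mod ?R) ! l) =
          (if ?v ! (d + l) = vertex_add ms ?u c ! (d + l) then 1 else 0)"
        unfolding nth vertex_add_nth_high[OF l(2)]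
        by (simp only: adj_K2_power_entry box_nth_high[OF _ l(2)] uv)
    qed (simp add: Ms_def)
    finally show ?thesis .
  qed
  also have "\<dots> = (if \<forall>l<r. ?v ! (d + l) = vertex_add ms ?u c ! (d + l) then 1 else 0)"
    by (auto intro: prod_zero)
  also have "i div ?R = j div ?R \<longleftrightarrow> (\<forall>l<d. ?v ! l = vertex_add ms ?u c ! l)"
  proof -
    have "i div ?R = j div ?R \<longleftrightarrow> digits ns (j div ?R) = digits ns (i div ?R)"
      using div by (auto simp only: digits_inj_iff)
    also have "\<dots> \<longleftrightarrow> (\<forall>l<d. ?v ! l = ?u ! l)"
      unfolding split by (simp add: list_eq_iff_nth_eq nth_append)
    finally show ?thesis using vertex_add_nth_low[OF assms uv(1)] by auto
  qed
  also have "(if \<forall>l<d. ?v ! l = vertex_add ms ?u c ! l then 1 else 0) *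
      (if \<forall>l<r. ?v ! (d + l) = vertex_add ms ?u c ! (d + l) then 1 else 0) =
      (if ?v = vertex_add ms ?u c then 1 else 0 :: complex)"
  proof -
    have "?v = vertex_add ms ?u c \<longleftrightarrow> (\<forall>l<d + r. ?v ! l = vertex_add ms ?u c ! l)"
      by (simp add: list_eq_iff_nth_eq)
    also have "\<dots> \<longleftrightarrow> (\<forall>l<d. ?v ! l = vertex_add ms ?u c ! l) \<and>
        (\<forall>l<r. ?v ! (d + l) = vertex_add ms ?u c ! (d + l))"
      by (rule all_less_add_iff)
    finally show ?thesis by auto
  qed
  finally show "kron_shift c $$ (i, j) = (if ?v = vertex_add ms ?u c then 1 else 0)" .
qed

lemma transition_mat_G:
  "transition_mat G (pi / 2) = (- \<i>) ^ card A \<cdot>\<^sub>m kron_shift (Z2_sum (d + r) A)"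
proof (rule eq_matI)
  note T = kron_shift_carrier_entry[OF Z2_sum_shifts]
  show "dim_row (transition_mat G (pi / 2)) = dim_row ((- \<i>) ^ card A \<cdot>\<^sub>m kron_shift (Z2_sum (d + r) A))"
    "dim_col (transition_mat G (pi / 2)) = dim_col ((- \<i>) ^ card A \<cdot>\<^sub>m kron_shift (Z2_sum (d + r) A))"
    using transition_mat_G_carrier[of "pi / 2"] T(1) by (simp_all only: index_smult_mat carrier_matD)
  fix i j
  assume "i < dim_row ((- \<i>) ^ card A \<cdot>\<^sub>m kron_shift (Z2_sum (d + r) A))"
    "j < dim_col ((- \<i>) ^ card A \<cdot>\<^sub>m kron_shift (Z2_sum (d + r) A))"
  then have ij: "i < N" "j < N" using T(1) by (simp_all only: index_smult_mat carrier_matD)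
  then have "((- \<i>) ^ card A \<cdot>\<^sub>m kron_shift (Z2_sum (d + r) A)) $$ (i, j) =
      (- \<i>) ^ card A * kron_shift (Z2_sum (d + r) A) $$ (i, j)"
    using T(1) by (intro index_smult_mat) (auto simp only: carrier_matD)
  then show "transition_mat G (pi / 2) $$ (i, j) =
      ((- \<i>) ^ card A \<cdot>\<^sub>m kron_shift (Z2_sum (d + r) A)) $$ (i, j)"
    using ij by (simp only: transition_mat_G_entry T(2) if_distrib[of "(*) _"] mult_1_right mult_zero_right)
qed

section \<open>From matrix indices back to vertices\<close>

lemma transition_entry_G:
  assumes "u \<in> pverts G" "v \<in> pverts G"
  shows "transition_entry G (pi / 2) u v =
    (if v = vertex_add ms u (Z2_sum (d + r) A) then (- \<i>) ^ card A else 0)"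
proof -
  have index: "vertex_index G w < N" "digits ms (vertex_index G w) = w" if "w \<in> pverts G" for w
  proof -
    have "finite (pverts G)" by (simp only: pverts_G finite_box)
    note vi = vertex_index[OF this that]
    show "vertex_index G w < N" using vi(1) by (simp only: pverts_G card_box)
    then show "digits ms (vertex_index G w) = w"
      using vi(2) by (simp only: vertex_list_G nth_map length_upt nth_upt diff_zero add_0)
  qed
  show ?thesis
    unfolding transition_entry_def
    using index[OF assms(1)] index[OF assms(2)] by (simp only: transition_mat_G_entry)
qed

text \<open>By freeness of the action only the zero vector fixes a vertex. This separates perfect
  state transfer, which needs two distinct vertices, from periodicity.\<close>

lemma vertex_add_eq_self_iff:
  assumes "a \<in> shifts" "u \<in> box ms"
  shows "vertex_add ms u a = u \<longleftrightarrow> a = Z2_zero (d + r)"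
proof -
  have zero: "Z2_zero (d + r) \<in> shifts" by (simp add: shifts_def Z2_zero_def)
  have "vertex_add ms u (Z2_zero (d + r)) = u"
    using assms(2) by (auto simp: vertex_add_def Z2_zero_def box_def intro!: nth_equalityI)
  then show ?thesis using vertex_add_inj[OF assms(1) zero, of u] by auto
qed

end

theorem theorem1p2:
  fixes d r :: nat and ns :: "nat list" and A :: "bit list set"
    and c :: "bit list" and G :: "nat list pair_pre_digraph"
  assumes "d \<ge> 1" and "r \<ge> 1"
    and "length ns = d" and "\<forall>n\<in>set ns. n \<ge> 3"
    and "A \<noteq> {}" and "A \<subseteq> Z2_space (d + r) - {Z2_zero (d + r)}"
    and "\<forall>a\<in>A. \<forall>i<d. a ! i = 0"
  defines "c \<equiv> Z2_sum (d + r) A"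
    and "G \<equiv> neps (map complete_graph (ns @ replicate r 2)) A"
  shows "(c \<noteq> Z2_zero (d + r) \<longrightarrow>
           (\<forall>u\<in>pverts G. perfect_state_transfer G u (vertex_add (ns @ replicate r 2) u c) (pi / 2)) \<and>
           transition_mat G (pi / 2) =
             (- \<i>) ^ card A \<cdot>\<^sub>m
               (1\<^sub>m (prod_list ns) \<otimes>\<^sub>K
                 kron_list (map (\<lambda>j. adj_mat (complete_graph 2) ^\<^sub>m of_bit (c ! j)) [d..<d + r]))) \<and>
         (c = Z2_zero (d + r) \<longrightarrow>
           periodic_graph G (pi / 2) \<and>
           transition_mat G (pi / 2) = (- \<i>) ^ card A \<cdot>\<^sub>m 1\<^sub>m (2 ^ r * prod_list ns))"
proof -
  interpret N: cubelike_neps ns r A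
    using assms by unfold_locales (auto simp: Z2_space_def)
  have len: "length ns = d" by fact
  have c: "c \<in> N.shifts" using N.Z2_sum_shifts by (simp only: c_def len)
  note verts = N.pverts_G[folded G_def]
  have closed: "vertex_add (ns @ replicate r 2) u c \<in> pverts G" if "u \<in> pverts G" for u
    using that N.vertex_add_in_box[OF c] by (simp only: verts)
  have fixed: "vertex_add (ns @ replicate r 2) u c = u \<longleftrightarrow> c = Z2_zero (d + r)" if "u \<in> pverts G" for u
    using that N.vertex_add_eq_self_iff[OF c] by (simp only: verts len)
  have entry: "cmod (transition_entry G (pi / 2) u (vertex_add (ns @ replicate r 2) u c)) = 1"
    if "u \<in> pverts G" for u
    using N.transition_entry_G[folded G_def, unfolded len, folded c_def, OF that closed[OF that]]
    by (simp add: norm_power)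
  have mat: "transition_mat G (pi / 2) = (- \<i>) ^ card A \<cdot>\<^sub>m N.kron_shift c"
    using N.transition_mat_G by (simp only: G_def c_def len)
  \<comment> \<open>For c = 0 the translation fixes every vertex, so its permutation matrix is the
    identity.\<close>
  have one: "N.kron_shift c = 1\<^sub>m (2 ^ r * prod_list ns)" if "c = Z2_zero (d + r)"
  proof (rule eq_matI)
    have N: "2 ^ r * prod_list ns = N.N" by (simp add: mult.commute)
    show "dim_row (N.kron_shift c) = dim_row (1\<^sub>m (2 ^ r * prod_list ns))"
      "dim_col (N.kron_shift c) = dim_col (1\<^sub>m (2 ^ r * prod_list ns))"
      using carrier_matD[OF N.kron_shift_carrier_entry(1)[OF c]] by (simp_all only: N index_one_mat)
    fix i j assume "i < dim_row (1\<^sub>m (2 ^ r * prod_list ns))" "j < dim_col (1\<^sub>m (2 ^ r * prod_list ns))"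
    then have ij: "i < N.N" "j < N.N" by (simp_all only: N index_one_mat)
    have "vertex_add (ns @ replicate r 2) (digits (ns @ replicate r 2) i) c = digits (ns @ replicate r 2) i"
      using that ij fixed by (simp only: verts digits_in_box)
    then show "N.kron_shift c $$ (i, j) = 1\<^sub>m (2 ^ r * prod_list ns) $$ (i, j)"
      using N.kron_shift_carrier_entry(2)[OF c ij] ij
      by (simp only: digits_inj_iff N index_one_mat eq_commute)
  qed
  \<comment> \<open>Both cases rest on \<open>entry\<close>, the unit modulus of the entry from u to
    its translate; \<open>fixed\<close> decides whether that translate is another vertex or u
    itself.\<close>
  have "perfect_state_transfer G u (vertex_add (ns @ replicate r 2) u c) (pi / 2)"
    if "c \<noteq> Z2_zero (d + r)" "u \<in> pverts G" for u
    unfolding perfect_state_transfer_def using that entry closed fixed by metis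
  moreover have "periodic_graph G (pi / 2)" if "c = Z2_zero (d + r)"
    unfolding periodic_graph_def using that entry fixed by metis
  ultimately show ?thesis
    using mat one unfolding len by (intro conjI impI ballI) (simp_all only: not_False_eq_True)
qed

end
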